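(* Let $f:\mathbb{R}\to\mathbb{R}$ be continuously differentiable, let $\alpha\in(0,1]$, and let $x,c\in\mathbb{R}$ with $x\neq c$. Define $\zeta_x(t)=f(t)-f(x)-f'(x)(t-x)$ for $t\in\mathbb{R}$. Then $${}^{C}D^{\alpha}_{c}f(x)-\frac{f'(x)(x-c)}{\Gamma(2-\alpha)|x-c|^{\alpha}}=\frac{-\zeta_x(c)}{\Gamma(1-\alpha)|x-c|^{\alpha}}-\frac{\alpha\,\operatorname{sgn}(x-c)}{\Gamma(1-\alpha)}\int_c^x\frac{\zeta_x(t)}{|x-t|^{\alpha+1}}\,dt .$$
   Context: $\operatorname{sgn}$ is the sign function and $\Gamma$ the gamma function. For $0<\alpha<1$ and $x\ne c$ (either $x>c$ or $x<c$), the Caputo derivative of order $\alpha$ with terminal $c$ is $${}^{C}D^{\alpha}_{c}f(x)=\frac{1}{\Gamma(1-\alpha)}\int_c^x\frac{f'(t)}{|x-t|^{\alpha}}\,dt,$$ where $\int_c^x$ is the oriented integral. Convention at $\alpha=1$: ${}^{C}D^{1}_{c}f(x)$ is the limiting value $\operatorname{sgn}(x-c)f'(x)$, and every term carrying the factor $1/\Gamma(1-\alpha)=1/\Gamma(0)$ is read as $0$. *)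

theory Defs
  imports "HOL-Analysis.Analysis"
begin

(* The interval integral LBINT t=c..x is oriented: it changes sign for x < c.  Only real orders
   0 < \<alpha> \<le> 1 and x \<noteq> c are meaningful; \<alpha> = 1 is the limiting value.  At the single point t = x
   the integrand takes the default value 0, which does not affect the integral. *)
definition caputo_deriv :: "real \<Rightarrow> real \<Rightarrow> (real \<Rightarrow> real) \<Rightarrow> real \<Rightarrow> real" where
  "caputo_deriv \<alpha> c f x =
     (if \<alpha> = 1 then sgn (x - c) * deriv f x
      else 1 / Gamma (1 - \<alpha>) * (LBINT t=c..x. deriv f t / \<bar>x - t\<bar> powr \<alpha>))"

definition zeta_rem :: "(real \<Rightarrow> real) \<Rightarrow> real \<Rightarrow> real \<Rightarrow> real" where
  "zeta_rem f x t = f t - f x - deriv f x * (t - x)"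

(* Gamma has the value 0 at its poles and division by 0 yields 0, so every term that is divided
   by Gamma (1 - \<alpha>) is 0 at \<alpha> = 1.  This is the convention 1 / Gamma 0 = 0. *)
lemma divide_Gamma_0: "y / Gamma (0::real) = 0"
  by simp

end

theory Submission
  imports Defs
begin

text \<open>Let \<open>\<alpha> < 1\<close>, write \<open>\<zeta>\<close> for the Taylor remainder \<open>zeta_rem f x\<close>, and \<open>s = sgn (x - c)\<close>. Since
\<open>\<zeta>' t = f' t - f' x\<close>, the Caputo integrand splits as
\<open>f' t * \<bar>x - t\<bar> powr - \<alpha> = \<zeta>' t * \<bar>x - t\<bar> powr - \<alpha> + f' x * \<bar>x - t\<bar> powr - \<alpha>\<close>.
The last summand has an elementary integral (\<open>abs_powr_kernel_integral\<close>), and with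
\<open>\<Gamma> (2 - \<alpha>) = (1 - \<alpha>) \<Gamma> (1 - \<alpha>)\<close> its contribution, divided by
\<open>\<Gamma> (1 - \<alpha>)\<close>, is exactly the term subtracted on the left of the claim. The first summand is integrated by parts (\<open>zeta_rem_integration_by_parts\<close>): differentiating the kernel produces
\<open>\<alpha> s \<bar>x - t\<bar> powr (- \<alpha> - 1)\<close>, and the boundary term at \<open>c\<close> gives the first term on
the right.

The singularity at \<open>t = x\<close> is harmless because of subtracting the tangent: \<open>f'\<close> is bounded on the compact
segment, so the mean value theorem gives \<open>\<bar>\<zeta> t\<bar> \<le> K \<bar>x - t\<bar>\<close> (\<open>zeta_rem_bounds\<close>). One power of
\<open>\<bar>x - t\<bar>\<close> gained in this way makes \<open>\<zeta> t * \<bar>x - t\<bar> powr (- \<alpha> - 1)\<close> comparable to the integrable kernel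
\<open>\<bar>x - t\<bar> powr - \<alpha>\<close>, and makes the boundary term at \<open>x\<close> vanish.

The positions \<open>c < x\<close> and \<open>x < c\<close> are treated together by working on the segment between \<open>c\<close> and \<open>x\<close>
with oriented integrals. At \<open>\<alpha> = 1\<close> both sides are \<open>0\<close>.\<close>

section \<open>Oriented integrals over a segment\<close>

lemma interval_integrable_segment_iff:
  fixes c x :: real
  shows "interval_lebesgue_integrable lborel c x g \<longleftrightarrow> set_integrable lborel (open_segment c x) g"
  by (auto simp: interval_lebesgue_integrable_def open_segment_eq_real_ivl)

lemma segment_endpoint_limits:
  fixes F :: "real \<Rightarrow> real" and a b :: real
  assumes "a < b" and "continuous_on {a..b} F"
  shows "((F \<circ> real_of_ereal) \<longlongrightarrow> F a) (at_right (ereal a))"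
    and "((F \<circ> real_of_ereal) \<longlongrightarrow> F b) (at_left (ereal b))"
  using assms
  by (auto simp: ereal_tendsto_simps1 continuous_on_Icc_at_rightD continuous_on_Icc_at_leftD)

text \<open>The derivative may be unbounded at the endpoints, which is the case for weakly singular kernels:
continuity of the primitive up to the endpoints and integrability of the derivative replace
continuity of the derivative there. The integral is oriented, so \<open>c\<close> and \<open>x\<close> may be in either order.\<close>

lemma interval_integral_FTC_segment:
  fixes F g :: "real \<Rightarrow> real" and c x :: real
  assumes "c \<noteq> x"
    and F: "continuous_on (closed_segment c x) F"
    and deriv: "\<And>t. t \<in> open_segment c x \<Longrightarrow> (F has_real_derivative g t) (at t)"
    and g: "continuous_on (open_segment c x) g"
    and int: "interval_lebesgue_integrable lborel c x g"
  shows "(LBINT t=c..x. g t) = F x - F c"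
proof -
  define a b where "a = min c x" and "b = max c x"
  have ab: "a < b" and op: "open_segment c x = {a<..<b}" and cl: "closed_segment c x = {a..b}"
    using \<open>c \<noteq> x\<close> by (auto simp: a_def b_def open_segment_eq_real_ivl closed_segment_eq_real_ivl)
  have "(LBINT t=a..b. g t) = F b - F a"
  proof (rule interval_integral_FTC_integrable)
    show "isCont g t" if "ereal a < ereal t" "ereal t < ereal b" for t
      using g that by (simp add: op continuous_on_eq_continuous_at)
    show "set_integrable lborel (einterval (ereal a) (ereal b)) g"
      using int by (simp add: interval_integrable_segment_iff op)
  qed (use ab deriv segment_endpoint_limits[OF ab F[unfolded cl]] in
        \<open>auto simp: op has_real_derivative_iff_has_vector_derivative[symmetric]\<close>)
  then show ?thesis
    using interval_integral_endpoints_reverse[of "ereal c" "ereal x" g]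
    by (cases "c \<le> x") (auto simp: a_def b_def)
qed

text \<open>The integrals of a nonnegative derivative over compact subintervals are bounded by the total increase
of its primitive, so monotone convergence gives integrability up to a singular endpoint. The sign
condition is on \<open>g\<close> and does not depend on the orientation of the segment.\<close>

lemma interval_integrable_nonneg_derivative:
  fixes F g :: "real \<Rightarrow> real" and c x :: real
  assumes "c \<noteq> x"
    and F: "continuous_on (closed_segment c x) F"
    and deriv: "\<And>t. t \<in> open_segment c x \<Longrightarrow> (F has_real_derivative g t) (at t)"
    and g: "continuous_on (open_segment c x) g"
    and nonneg: "\<And>t. t \<in> open_segment c x \<Longrightarrow> 0 \<le> g t"
  shows "interval_lebesgue_integrable lborel c x g"
proof -
  define a b where "a = min c x" and "b = max c x"
  have ab: "a < b" and op: "open_segment c x = {a<..<b}" and cl: "closed_segment c x = {a..b}"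
    using \<open>c \<noteq> x\<close> by (auto simp: a_def b_def open_segment_eq_real_ivl closed_segment_eq_real_ivl)
  have "set_integrable lborel (einterval (ereal a) (ereal b)) g"
  proof (rule interval_integral_FTC_nonneg(1))
    show "isCont g t" if "ereal a < ereal t" "ereal t < ereal b" for t
      using g that by (simp add: op continuous_on_eq_continuous_at)
  qed (use ab deriv nonneg segment_endpoint_limits[OF ab F[unfolded cl]] in \<open>auto simp: op\<close>)
  then show ?thesis
    by (simp add: interval_integrable_segment_iff op)
qed

lemma interval_integrable_dominated:
  fixes g h :: "real \<Rightarrow> real" and c x :: real
  assumes h: "interval_lebesgue_integrable lborel c x h"
    and g: "continuous_on (open_segment c x) g"
    and le: "\<And>t. t \<in> open_segment c x \<Longrightarrow> \<bar>g t\<bar> \<le> h t"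
  shows "interval_lebesgue_integrable lborel c x g"
  unfolding interval_integrable_segment_iff
proof (rule set_integrable_bound)
  show "set_integrable lborel (open_segment c x) h"
    using h by (simp add: interval_integrable_segment_iff)
  have "open_segment c x \<in> sets borel"
    by (simp add: open_segment_eq_real_ivl)
  then show "set_borel_measurable lborel (open_segment c x) g"
    unfolding set_borel_measurable_def
    using borel_measurable_continuous_on_indicator[OF _ g] by simp
  show "AE t in lborel. t \<in> open_segment c x \<longrightarrow> norm (g t) \<le> norm (h t)"
    using le by (intro AE_I2) force
qed

section \<open>The kernel\<close>

lemma has_real_derivative_abs_powr:
  fixes c x t r :: real
  assumes "t \<in> open_segment c x"
  shows "((\<lambda>t. \<bar>x - t\<bar> powr r) has_real_derivative
           - sgn (x - c) * r * \<bar>x - t\<bar> powr (r - 1)) (at t)"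
proof -
  (* The sign of x - t is constant on the open segment, so the absolute value is linear there. *)
  have abs: "\<bar>x - u\<bar> = sgn (x - c) * (x - u)" "0 < \<bar>x - u\<bar>" if "u \<in> open_segment c x" for u
    using that by (auto simp: open_segment_eq_real_ivl sgn_if split: if_splits)
  have "((\<lambda>u. (sgn (x - c) * (x - u)) powr r) has_real_derivative
           - sgn (x - c) * r * \<bar>x - t\<bar> powr (r - 1)) (at t)"
    using abs[OF assms] by (auto intro!: derivative_eq_intros)
  moreover have "open (open_segment c x)"
    by (simp add: open_segment_eq_real_ivl)
  ultimately show ?thesis
    by (rule has_field_derivative_transform_within_open[OF _ _ assms]) (simp add: abs)
qed

lemma abs_powr_kernel_integral:
  fixes c x \<alpha> :: real
  assumes "c \<noteq> x" and "\<alpha> < 1"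
  shows "interval_lebesgue_integrable lborel c x (\<lambda>t. \<bar>x - t\<bar> powr - \<alpha>)"
    and "(LBINT t=c..x. \<bar>x - t\<bar> powr - \<alpha>) = (x - c) / ((1 - \<alpha>) * \<bar>x - c\<bar> powr \<alpha>)"
proof -
  (* The antiderivative that vanishes at the singularity t = x, negative for t < x and positive for
     t > x, hence increasing for either position of c. *)
  define H where "H t = - sgn (x - c) / (1 - \<alpha>) * \<bar>x - t\<bar> powr (1 - \<alpha>)" for t
  have H: "continuous_on (closed_segment c x) H"
    unfolding H_def using assms by (intro continuous_intros continuous_on_powr') auto
  have deriv: "(H has_real_derivative \<bar>x - t\<bar> powr - \<alpha>) (at t)" if "t \<in> open_segment c x" for t
    unfolding H_def
    using DERIV_cmult[OF has_real_derivative_abs_powr[OF that, of "1 - \<alpha>"], of "- sgn (x - c) / (1 - \<alpha>)"]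
      assms by (auto simp: sgn_if split: if_splits)
  have cont: "continuous_on (open_segment c x) (\<lambda>t. \<bar>x - t\<bar> powr - \<alpha>)"
    by (intro continuous_intros) (auto simp: open_segment_def)
  show int: "interval_lebesgue_integrable lborel c x (\<lambda>t. \<bar>x - t\<bar> powr - \<alpha>)"
    by (rule interval_integrable_nonneg_derivative[OF assms(1) H deriv cont]) auto
  have "(LBINT t=c..x. \<bar>x - t\<bar> powr - \<alpha>) = H x - H c"
    by (rule interval_integral_FTC_segment[OF assms(1) H deriv cont int])
  also have "\<dots> = sgn (x - c) * \<bar>x - c\<bar> / ((1 - \<alpha>) * \<bar>x - c\<bar> powr \<alpha>)"
    using assms by (simp add: H_def powr_diff)
  finally show "(LBINT t=c..x. \<bar>x - t\<bar> powr - \<alpha>) = (x - c) / ((1 - \<alpha>) * \<bar>x - c\<bar> powr \<alpha>)"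
    by (simp add: sgn_mult_abs)
qed

section \<open>The Taylor remainder\<close>

lemma C1_deriv:
  assumes "f C1_differentiable_on (UNIV :: real set)"
  shows "(f has_real_derivative deriv f t) (at t)" and "continuous_on S (deriv f)"
proof -
  obtain D where D: "\<And>t. (f has_real_derivative D t) (at t)" "continuous_on UNIV D"
    using assms
    by (auto simp: C1_differentiable_on_def has_real_derivative_iff_has_vector_derivative)
  have "deriv f = D"
    using D(1) by (intro ext DERIV_imp_deriv)
  then show "(f has_real_derivative deriv f t) (at t)" "continuous_on S (deriv f)"
    using D(1) continuous_on_subset[OF D(2) subset_UNIV] by simp_all
qed

lemma zeta_rem_has_derivative:
  assumes "(f has_real_derivative deriv f t) (at t)"
  shows "(zeta_rem f x has_real_derivative deriv f t - deriv f x) (at t)"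
  unfolding zeta_rem_def using assms by (auto intro!: derivative_eq_intros)

text \<open>The second bound is the mean value theorem on the segment from \<open>t\<close> to \<open>x\<close>, using that \<open>\<zeta>\<close> vanishes
at \<open>x\<close> and that its derivative is the difference in the first bound.\<close>

lemma zeta_rem_bounds:
  fixes f :: "real \<Rightarrow> real" and c x :: real
  assumes "f C1_differentiable_on UNIV"
  obtains K where "\<And>t. t \<in> closed_segment c x \<Longrightarrow> \<bar>deriv f t - deriv f x\<bar> \<le> K"
    and "\<And>t. t \<in> closed_segment c x \<Longrightarrow> \<bar>zeta_rem f x t\<bar> \<le> K * \<bar>x - t\<bar>"
proof -
  have "bounded ((\<lambda>t. deriv f t - deriv f x) ` closed_segment c x)"
    by (intro compact_imp_bounded compact_continuous_image continuous_intros C1_deriv(2)[OF assms]) auto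
  then obtain K where "\<forall>t\<in>closed_segment c x. \<bar>deriv f t - deriv f x\<bar> \<le> K"
    by (auto simp: bounded_iff)
  then have K: "\<And>t. t \<in> closed_segment c x \<Longrightarrow> \<bar>deriv f t - deriv f x\<bar> \<le> K"
    by blast
  have "\<bar>zeta_rem f x t\<bar> \<le> K * \<bar>x - t\<bar>" if t: "t \<in> closed_segment c x" for t
  proof -
    have "norm (zeta_rem f x x - zeta_rem f x t) \<le> K * norm (x - t)"
    proof (rule field_differentiable_bound[of "closed_segment c x"])
      show "(zeta_rem f x has_field_derivative deriv f u - deriv f x) (at u within closed_segment c x)" for u
        by (rule has_field_derivative_at_within[OF zeta_rem_has_derivative[OF C1_deriv(1)[OF assms]]])
    qed (use K t in auto)
    then show ?thesis
      by (simp add: zeta_rem_def)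
  qed
  with K show thesis
    by (rule that)
qed

text \<open>The linear bound on the remainder raises the exponent of the kernel by one. For \<open>\<alpha> < 1\<close>, the choice
\<open>r = - \<alpha> - 1\<close> yields an integrable majorant and \<open>r = - \<alpha>\<close> a majorant that tends to \<open>0\<close> at \<open>x\<close>.\<close>

lemma abs_zeta_rem_powr_le:
  fixes f :: "real \<Rightarrow> real" and x t r K :: real
  assumes "\<bar>zeta_rem f x t\<bar> \<le> K * \<bar>x - t\<bar>"
  shows "\<bar>zeta_rem f x t * \<bar>x - t\<bar> powr r\<bar> \<le> K * \<bar>x - t\<bar> powr (r + 1)"
proof -
  have "\<bar>zeta_rem f x t * \<bar>x - t\<bar> powr r\<bar> \<le> K * \<bar>x - t\<bar> * \<bar>x - t\<bar> powr r"
    using assms by (auto simp: abs_mult intro!: mult_right_mono)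
  also have "\<dots> = K * \<bar>x - t\<bar> powr (r + 1)"
    by (cases "t = x") (auto simp: powr_add)
  finally show ?thesis .
qed

section \<open>Integration by parts\<close>

context
  fixes f :: "real \<Rightarrow> real" and \<alpha> x c :: real
  assumes C1: "f C1_differentiable_on UNIV" and \<alpha>: "0 < \<alpha>" "\<alpha> < 1" and xc: "x \<noteq> c"
begin

lemma continuous_on_zeta_rem: "continuous_on S (zeta_rem f x)"
  using DERIV_isCont[OF zeta_rem_has_derivative[OF C1_deriv(1)[OF C1]]]
  by (intro continuous_at_imp_continuous_on ballI)

lemma integrable_derivative_increment:
  "interval_lebesgue_integrable lborel c x (\<lambda>t. (deriv f t - deriv f x) * \<bar>x - t\<bar> powr - \<alpha>)"
proof -
  obtain K where K: "\<And>t. t \<in> closed_segment c x \<Longrightarrow> \<bar>deriv f t - deriv f x\<bar> \<le> K"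
    by (rule zeta_rem_bounds[OF C1, of c x]) blast
  show ?thesis
  proof (rule interval_integrable_dominated)
    show "interval_lebesgue_integrable lborel c x (\<lambda>t. K * \<bar>x - t\<bar> powr - \<alpha>)"
      using abs_powr_kernel_integral(1)[of c x \<alpha>] \<alpha> xc by simp
    show "continuous_on (open_segment c x) (\<lambda>t. (deriv f t - deriv f x) * \<bar>x - t\<bar> powr - \<alpha>)"
      by (intro continuous_intros C1_deriv(2)[OF C1]) (auto simp: open_segment_def)
    show "\<bar>(deriv f t - deriv f x) * \<bar>x - t\<bar> powr - \<alpha>\<bar> \<le> K * \<bar>x - t\<bar> powr - \<alpha>"
      if "t \<in> open_segment c x" for t
      using K[of t] that by (auto simp: abs_mult open_segment_def intro!: mult_right_mono)
  qed
qed

lemma integrable_zeta_rem: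
  "interval_lebesgue_integrable lborel c x (\<lambda>t. zeta_rem f x t * \<bar>x - t\<bar> powr (- \<alpha> - 1))"
proof -
  obtain K where K: "\<And>t. t \<in> closed_segment c x \<Longrightarrow> \<bar>zeta_rem f x t\<bar> \<le> K * \<bar>x - t\<bar>"
    by (rule zeta_rem_bounds[OF C1, of c x]) blast
  show ?thesis
  proof (rule interval_integrable_dominated)
    show "interval_lebesgue_integrable lborel c x (\<lambda>t. K * \<bar>x - t\<bar> powr - \<alpha>)"
      using abs_powr_kernel_integral(1)[of c x \<alpha>] \<alpha> xc by simp
    show "continuous_on (open_segment c x) (\<lambda>t. zeta_rem f x t * \<bar>x - t\<bar> powr (- \<alpha> - 1))"
      by (intro continuous_intros continuous_on_zeta_rem) (auto simp: open_segment_def)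
    show "\<bar>zeta_rem f x t * \<bar>x - t\<bar> powr (- \<alpha> - 1)\<bar> \<le> K * \<bar>x - t\<bar> powr - \<alpha>"
      if "t \<in> open_segment c x" for t
      using abs_zeta_rem_powr_le[OF K[of t], of "- \<alpha> - 1"] that by (auto simp: open_segment_def)
  qed
qed

text \<open>This is the boundary term of the integration by parts. At \<open>t = x\<close> the expression has the value \<open>0\<close>,
and \<open>0\<close> is also its limit, because the remainder decays faster than \<open>\<bar>x - t\<bar> powr \<alpha>\<close>.\<close>

lemma continuous_on_zeta_rem_powr:
  "continuous_on (closed_segment c x) (\<lambda>t. zeta_rem f x t * \<bar>x - t\<bar> powr - \<alpha>)" (is "continuous_on ?S ?G")
  unfolding continuous_on
proof
  fix t assume t: "t \<in> ?S"
  show "(?G \<longlongrightarrow> ?G t) (at t within ?S)"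
  proof (cases "t = x")
    case False
    moreover have "(zeta_rem f x \<longlongrightarrow> zeta_rem f x t) (at t within ?S)"
      using continuous_on_zeta_rem t by (auto simp: continuous_on)
    ultimately show ?thesis
      by (intro tendsto_intros) auto
  next
    case True
    obtain K where K: "\<And>u. u \<in> ?S \<Longrightarrow> \<bar>zeta_rem f x u\<bar> \<le> K * \<bar>x - u\<bar>"
      by (rule zeta_rem_bounds[OF C1, of c x]) blast
    have "continuous_on ?S (\<lambda>u. K * \<bar>x - u\<bar> powr (1 - \<alpha>))"
      using \<alpha> by (intro continuous_intros continuous_on_powr') auto
    then have "((\<lambda>u. K * \<bar>x - u\<bar> powr (1 - \<alpha>)) \<longlongrightarrow> 0) (at x within ?S)"
      unfolding continuous_on by (rule bspec[where x = x, THEN tendsto_eq_rhs]) auto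
    moreover have "\<forall>\<^sub>F u in at x within ?S. norm (?G u) \<le> K * \<bar>x - u\<bar> powr (1 - \<alpha>)"
      unfolding eventually_at_filter
      using abs_zeta_rem_powr_le[OF K, of _ "- \<alpha>"] by (auto simp: add.commute)
    ultimately have "(?G \<longlongrightarrow> 0) (at x within ?S)"
      by (rule Lim_null_comparison[rotated])
    then show ?thesis
      by (simp add: True)
  qed
qed

text \<open>Rather than splitting off an improper limit, the fundamental theorem is applied on the whole segment to
the product \<open>\<zeta> t * \<bar>x - t\<bar> powr - \<alpha>\<close>: both summands of its derivative are integrable separately.\<close>

lemma zeta_rem_integration_by_parts:
  "(LBINT t=c..x. (deriv f t - deriv f x) * \<bar>x - t\<bar> powr - \<alpha>) =
     - (zeta_rem f x c * \<bar>x - c\<bar> powr - \<alpha>)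
     - \<alpha> * sgn (x - c) * (LBINT t=c..x. zeta_rem f x t * \<bar>x - t\<bar> powr (- \<alpha> - 1))"
proof -
  let ?p = "\<lambda>t. (deriv f t - deriv f x) * \<bar>x - t\<bar> powr - \<alpha>"
  let ?q = "\<lambda>t. \<alpha> * sgn (x - c) * (zeta_rem f x t * \<bar>x - t\<bar> powr (- \<alpha> - 1))"
  have q: "interval_lebesgue_integrable lborel c x ?q"
    by (intro interval_lebesgue_integrable_mult_right integrable_zeta_rem)
  note sum = interval_lebesgue_integral_add[OF integrable_derivative_increment q]
  have "(LBINT t=c..x. ?p t + ?q t) =
      zeta_rem f x x * \<bar>x - x\<bar> powr - \<alpha> - zeta_rem f x c * \<bar>x - c\<bar> powr - \<alpha>"
  proof (rule interval_integral_FTC_segment[OF _ continuous_on_zeta_rem_powr _ _ sum(1)])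
    show "continuous_on (open_segment c x) (\<lambda>t. ?p t + ?q t)"
      by (intro continuous_intros continuous_on_zeta_rem C1_deriv(2)[OF C1]) (auto simp: open_segment_def)
    show "((\<lambda>t. zeta_rem f x t * \<bar>x - t\<bar> powr - \<alpha>) has_real_derivative ?p t + ?q t) (at t)"
      if "t \<in> open_segment c x" for t
      by (rule DERIV_cong[OF DERIV_mult[OF zeta_rem_has_derivative[OF C1_deriv(1)[OF C1]]
              has_real_derivative_abs_powr[OF that]]]) (simp add: mult_ac)
  qed (use xc in auto)
  then show ?thesis
    using sum(2) by simp
qed

lemma caputo_deriv_zeta_rem:
  shows "interval_lebesgue_integrable lborel c x (\<lambda>t. deriv f t / \<bar>x - t\<bar> powr \<alpha>)"
    and "interval_lebesgue_integrable lborel c x (\<lambda>t. zeta_rem f x t / \<bar>x - t\<bar> powr (\<alpha> + 1))"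
    and "caputo_deriv \<alpha> c f x - deriv f x * (x - c) / (Gamma (2 - \<alpha>) * \<bar>x - c\<bar> powr \<alpha>) =
           - zeta_rem f x c / (Gamma (1 - \<alpha>) * \<bar>x - c\<bar> powr \<alpha>)
           - \<alpha> * sgn (x - c) / Gamma (1 - \<alpha>) *
               (LBINT t=c..x. zeta_rem f x t / \<bar>x - t\<bar> powr (\<alpha> + 1))"
    (is "_ = _ - _ * ?I")
proof -
  let ?p = "\<lambda>t. (deriv f t - deriv f x) * \<bar>x - t\<bar> powr - \<alpha>"
  let ?k = "\<lambda>t. deriv f x * \<bar>x - t\<bar> powr - \<alpha>"
  have kernel: "(\<lambda>t. deriv f t / \<bar>x - t\<bar> powr \<alpha>) = (\<lambda>t. ?p t + ?k t)"
    by (simp add: powr_minus divide_inverse algebra_simps)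
  have remainder: "(\<lambda>t. zeta_rem f x t / \<bar>x - t\<bar> powr (\<alpha> + 1)) =
      (\<lambda>t. zeta_rem f x t * \<bar>x - t\<bar> powr (- \<alpha> - 1))"
  proof
    fix t
    have "- \<alpha> - 1 = - (\<alpha> + 1)"
      by simp
    then show "zeta_rem f x t / \<bar>x - t\<bar> powr (\<alpha> + 1) = zeta_rem f x t * \<bar>x - t\<bar> powr (- \<alpha> - 1)"
      by (simp only: powr_minus divide_inverse)
  qed
  have k: "interval_lebesgue_integrable lborel c x ?k"
    using abs_powr_kernel_integral(1)[of c x \<alpha>] \<alpha> xc by simp
  note sum = interval_lebesgue_integral_add[OF integrable_derivative_increment k]
  show "interval_lebesgue_integrable lborel c x (\<lambda>t. deriv f t / \<bar>x - t\<bar> powr \<alpha>)"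
    unfolding kernel by (rule sum(1))
  show "interval_lebesgue_integrable lborel c x (\<lambda>t. zeta_rem f x t / \<bar>x - t\<bar> powr (\<alpha> + 1))"
    unfolding remainder by (rule integrable_zeta_rem)
  have "1 - \<alpha> \<notin> \<int>\<^sub>\<le>\<^sub>0"
    using \<alpha> nonpos_Ints_nonpos[of "1 - \<alpha>"] by auto
  then have Gamma: "Gamma (2 - \<alpha>) = (1 - \<alpha>) * Gamma (1 - \<alpha>)"
    using Gamma_plus1[of "1 - \<alpha>"] by simp
  have integral: "(LBINT t=c..x. deriv f t / \<bar>x - t\<bar> powr \<alpha>) =
      - (zeta_rem f x c / \<bar>x - c\<bar> powr \<alpha>) - \<alpha> * sgn (x - c) * ?I
      + deriv f x * ((x - c) / ((1 - \<alpha>) * \<bar>x - c\<bar> powr \<alpha>))"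
    unfolding kernel remainder sum(2) zeta_rem_integration_by_parts
      interval_lebesgue_integral_mult_right abs_powr_kernel_integral(2)[OF xc[symmetric] \<alpha>(2)]
    by (simp only: powr_minus divide_inverse)
  have "1 / g * (- (z / p) - m * I + d * (y / (a * p))) - d * y / (a * g * p) =
      - z / (g * p) - m / g * I" for a d g m p y z I :: real
    by (simp add: divide_inverse algebra_simps)
  then show "caputo_deriv \<alpha> c f x - deriv f x * (x - c) / (Gamma (2 - \<alpha>) * \<bar>x - c\<bar> powr \<alpha>) =
           - zeta_rem f x c / (Gamma (1 - \<alpha>) * \<bar>x - c\<bar> powr \<alpha>)
           - \<alpha> * sgn (x - c) / Gamma (1 - \<alpha>) * ?I"
    using \<alpha> by (simp only: caputo_deriv_def integral Gamma less_irrefl if_False less_imp_neq)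
qed

end

theorem theorem3p4:
  fixes f :: "real \<Rightarrow> real" and \<alpha> x c :: real
  assumes "f C1_differentiable_on UNIV"
    and "0 < \<alpha>" and "\<alpha> \<le> 1"
    and "x \<noteq> c"
  shows "(\<alpha> < 1 \<longrightarrow>
            interval_lebesgue_integrable lborel c x (\<lambda>t. deriv f t / \<bar>x - t\<bar> powr \<alpha>) \<and>
            interval_lebesgue_integrable lborel c x (\<lambda>t. zeta_rem f x t / \<bar>x - t\<bar> powr (\<alpha> + 1))) \<and>
         caputo_deriv \<alpha> c f x - deriv f x * (x - c) / (Gamma (2 - \<alpha>) * \<bar>x - c\<bar> powr \<alpha>) =
           - zeta_rem f x c / (Gamma (1 - \<alpha>) * \<bar>x - c\<bar> powr \<alpha>)
           - \<alpha> * sgn (x - c) / Gamma (1 - \<alpha>) *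
               (LBINT t=c..x. zeta_rem f x t / \<bar>x - t\<bar> powr (\<alpha> + 1))"
proof (cases "\<alpha> = 1")
  case True
  (* Both sides vanish: on the left, Gamma 1 = 1 and the two terms cancel; on the right, every term
     is divided by Gamma 0 = 0. *)
  have "deriv f x * (x - c) / \<bar>x - c\<bar> = sgn (x - c) * deriv f x"
    using \<open>x \<noteq> c\<close> by (auto simp: sgn_if field_simps abs_if)
  with True show ?thesis
    using \<open>x \<noteq> c\<close> by (simp add: caputo_deriv_def)
next
  case False
  with assms show ?thesis
    using caputo_deriv_zeta_rem[of f \<alpha> x c] by simp
qed

end
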